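(* Let $r,t\in\mathcal{U}$, $s\in\mathcal{U}_0$, and let $p=(p_k)_{k\ge 0}$ be a bounded sequence of strictly positive real numbers with $H=\sup_kp_k$. (a) If $p_k>1$ for all $k$, then $[l(r,s,t,p;\Delta)]^\gamma=\Gamma_5(p)$; if $0<p_k\le1$ for all $k$, then $[l(r,s,t,p;\Delta)]^\gamma=\Gamma_4(p)$. (b) If $0<p_k\le H<\infty$ for all $k$, then (i) $[c_0(r,s,t,p;\Delta)]^\gamma=\Gamma_1(p)$, (ii) $[c(r,s,t,p;\Delta)]^\gamma=\Gamma_1(p)\cap\Gamma_2(p)$, (iii) $[l_\infty(r,s,t,p;\Delta)]^\gamma=\Gamma_3(p)$.
   Context: Let $w$ be the space of all real (or complex) sequences $x=(x_n)_{n\in\mathbb{N}_0}$. $\mathcal{U}=\{u\in w: u_n\neq 0\ \forall n\}$ and $\mathcal{U}_0=\{u\in w: u_0\ne 0\}$. Maddox's spaces: $l_\infty(p)=\{x\in w:\sup_k|x_k|^{p_k}<\infty\}$, $c(p)=\{x\in w:\lim_k|x_k-l|^{p_k}=0\text{ for some scalar }l\}$, $c_0(p)=\{x\in w:\lim_k|x_k|^{p_k}=0\}$, $l(p)=\{x\in w:\sum_k|x_k|^{p_k}<\infty\}$. Put $\Delta x_k=x_k-x_{k-1}$ with $x_{-1}=0$. For $X\in\{l_\infty(p),c(p),c_0(p),l(p)\}$, $$X(r,s,t,p;\Delta)=\Big\{x\in w:\Big(\frac1{r_n}\sum_{k=0}^n s_{n-k}t_k\Delta x_k\Big)_n\in X\Big\},$$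 written $l_\infty(r,s,t,p;\Delta)$, $c(r,s,t,p;\Delta)$, $c_0(r,s,t,p;\Delta)$, $l(r,s,t,p;\Delta)$ respectively. For $U\subseteq w$, the $\gamma$-dual is $U^\gamma=\{a\in w:(a_nu_n)_n\in bs\ \forall u\in U\}$, where $bs$ is the space of sequences with bounded partial sums. $D_0^{(s)}=1/s_0$ and, for $n\ge1$, $D_n^{(s)}=s_0^{-(n+1)}\det(s_{i-j+1})_{1\le i,j\le n}$ with $s_m=0$ for $m<0$. If $p_k>1$, $p_k'=p_k/(p_k-1)$. For $a=(a_k)\in w$ define the matrix $E=(e_{nk})$ by $$e_{nk}=r_k\Big[\frac{a_k}{s_0t_k}+\Big(\frac{D_0^{(s)}}{t_k}-\frac{D_1^{(s)}}{t_{k+1}}\Big)\sum_{j=k+1}^na_j+\sum_{l=k+2}^n(-1)^{l-k}\frac{D_{l-k}^{(s)}}{t_l}\Big(\sum_{j=l}^na_j\Big)\Big]\quad(0\le k\le n),\qquad e_{nk}=0\quad(k>n),$$ where sums with upper limit less than lower limit are $0$. Define $$\Gamma_1(p)=\bigcup_{L\in\mathbb{N}}\Big\{a\in w:\sup_{n\in\mathbb{N}_0}\sum_{k=0}^\infty|e_{nk}|L^{-1/p_k}<\infty\Big\},\quad \Gamma_2(p)=\Big\{a\in w:\sup_{n\in\mathbb{N}_0}\Big|\sum_{k=0}^\infty e_{nk}\Big|<\infty\Big\},$$ $$\Gamma_3(p)=\bigcap_{L\in\mathbb{N}}\Big\{a\in w:\sup_{n\in\mathbb{N}_0}\sum_{k=0}^\infty|e_{nk}|L^{1/p_k}<\infty\Big\},\quad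 \Gamma_4(p)=\bigcup_{L\in\mathbb{N}}\Big\{a\in w:\sup_{n\in\mathbb{N}_0}\sup_{k\in\mathbb{N}_0}|e_{nk}L^{-1}|^{p_k}<\infty\Big\},$$ $$\Gamma_5(p)=\bigcup_{L\in\mathbb{N}}\Big\{a\in w:\sup_{n\in\mathbb{N}_0}\sum_{k=0}^\infty|e_{nk}L^{-1}|^{p_k'}<\infty\Big\}.$$ *)

theory Defs
  imports Complex_Main "Jordan_Normal_Form.Determinant"
begin

text \<open>
  Scalars are of class \<^class>\<open>real_normed_field\<close>, which has \<^typ>\<open>real\<close> and \<^typ>\<open>complex\<close> as
  instances (and, the norm being multiplicative, no others up to isomorphism). Exponents are
  real sequences; \<open>\<bar>z\<bar>\<^sup>q\<close> is \<open>norm z powr q\<close>, which is 0 at \<open>z = 0\<close>.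
\<close>

definition maddox_linf :: "(nat \<Rightarrow> real) \<Rightarrow> (nat \<Rightarrow> 'a::real_normed_field) set" where
  "maddox_linf p = {x. bdd_above (range (\<lambda>k. norm (x k) powr p k))}"

definition maddox_c :: "(nat \<Rightarrow> real) \<Rightarrow> (nat \<Rightarrow> 'a::real_normed_field) set" where
  "maddox_c p = {x. \<exists>l. (\<lambda>k. norm (x k - l) powr p k) \<longlonglongrightarrow> 0}"

definition maddox_c0 :: "(nat \<Rightarrow> real) \<Rightarrow> (nat \<Rightarrow> 'a::real_normed_field) set" where
  "maddox_c0 p = {x. (\<lambda>k. norm (x k) powr p k) \<longlonglongrightarrow> 0}"

definition maddox_l :: "(nat \<Rightarrow> real) \<Rightarrow> (nat \<Rightarrow> 'a::real_normed_field) set" where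
  "maddox_l p = {x. summable (\<lambda>k. norm (x k) powr p k)}"

definition backward_diff :: "(nat \<Rightarrow> 'a::real_normed_field) \<Rightarrow> nat \<Rightarrow> 'a" where
  "backward_diff x k = x k - (if k = 0 then 0 else x (k - 1))"

definition mean_diff_space ::
  "(nat \<Rightarrow> 'a) set \<Rightarrow> (nat \<Rightarrow> 'a) \<Rightarrow> (nat \<Rightarrow> 'a) \<Rightarrow> (nat \<Rightarrow> 'a) \<Rightarrow> (nat \<Rightarrow> 'a::real_normed_field) set" where
  "mean_diff_space X r s t =
     {x. (\<lambda>n. 1 / r n * (\<Sum>k=0..n. s (n - k) * t k * backward_diff x k)) \<in> X}"

definition linf_space where "linf_space r s t p = mean_diff_space (maddox_linf p) r s t"
definition c_space where "c_space r s t p = mean_diff_space (maddox_c p) r s t"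
definition c0_space where "c0_space r s t p = mean_diff_space (maddox_c0 p) r s t"
definition l_space where "l_space r s t p = mean_diff_space (maddox_l p) r s t"

definition bs :: "(nat \<Rightarrow> 'a::real_normed_field) set" where
  "bs = {x. Bseq (\<lambda>n. \<Sum>k=0..n. x k)}"

definition gamma_dual :: "(nat \<Rightarrow> 'a::real_normed_field) set \<Rightarrow> (nat \<Rightarrow> 'a) set" where
  "gamma_dual U = {a. \<forall>u\<in>U. (\<lambda>n. a n * u n) \<in> bs}"

text \<open>
  The matrix indices below start at 0 instead of 1, which does not affect the entries
  \<open>s\<^bsub>i-j+1\<^esub>\<close>; the conditional implements \<open>s\<^bsub>m\<^esub> = 0\<close> for \<open>m < 0\<close>.
\<close>

definition Dcoeff :: "(nat \<Rightarrow> 'a::real_normed_field) \<Rightarrow> nat \<Rightarrow> 'a" where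
  "Dcoeff s n =
     (if n = 0 then 1 / s 0
      else 1 / s 0 ^ (n + 1) *
           det (mat n n (\<lambda>(i, j). if j \<le> i + 1 then s (i + 1 - j) else 0)))"

definition E_mat ::
  "(nat \<Rightarrow> 'a::real_normed_field) \<Rightarrow> (nat \<Rightarrow> 'a) \<Rightarrow> (nat \<Rightarrow> 'a) \<Rightarrow> (nat \<Rightarrow> 'a) \<Rightarrow> nat \<Rightarrow> nat \<Rightarrow> 'a" where
  "E_mat r s t a n k =
     (if k \<le> n then
        r k * (a k / (s 0 * t k)
          + (Dcoeff s 0 / t k - Dcoeff s 1 / t (k + 1)) * (\<Sum>j=k+1..n. a j)
          + (\<Sum>l=k+2..n. (- 1) ^ (l - k) * (Dcoeff s (l - k) / t l) * (\<Sum>j=l..n. a j)))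
      else 0)"

text \<open>
  Every row of \<^const>\<open>E_mat\<close> has finite support, so each \<^const>\<open>suminf\<close> below is a genuine
  (finite) sum. The parameter \<open>L\<close> ranges over the positive integers.
\<close>

definition Gamma1 ::
  "(nat \<Rightarrow> 'a::real_normed_field) \<Rightarrow> (nat \<Rightarrow> 'a) \<Rightarrow> (nat \<Rightarrow> 'a) \<Rightarrow> (nat \<Rightarrow> real) \<Rightarrow> (nat \<Rightarrow> 'a) set" where
  "Gamma1 r s t p = (\<Union>L\<in>{1::nat..}.
     {a. bdd_above (range (\<lambda>n. \<Sum>k. norm (E_mat r s t a n k) * real L powr (- 1 / p k)))})"

definition Gamma2 ::
  "(nat \<Rightarrow> 'a::real_normed_field) \<Rightarrow> (nat \<Rightarrow> 'a) \<Rightarrow> (nat \<Rightarrow> 'a) \<Rightarrow> (nat \<Rightarrow> 'a) set" where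
  "Gamma2 r s t = {a. bdd_above (range (\<lambda>n. norm (\<Sum>k. E_mat r s t a n k)))}"

definition Gamma3 ::
  "(nat \<Rightarrow> 'a::real_normed_field) \<Rightarrow> (nat \<Rightarrow> 'a) \<Rightarrow> (nat \<Rightarrow> 'a) \<Rightarrow> (nat \<Rightarrow> real) \<Rightarrow> (nat \<Rightarrow> 'a) set" where
  "Gamma3 r s t p = (\<Inter>L\<in>{1::nat..}.
     {a. bdd_above (range (\<lambda>n. \<Sum>k. norm (E_mat r s t a n k) * real L powr (1 / p k)))})"

definition Gamma4 ::
  "(nat \<Rightarrow> 'a::real_normed_field) \<Rightarrow> (nat \<Rightarrow> 'a) \<Rightarrow> (nat \<Rightarrow> 'a) \<Rightarrow> (nat \<Rightarrow> real) \<Rightarrow> (nat \<Rightarrow> 'a) set" where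
  "Gamma4 r s t p = (\<Union>L\<in>{1::nat..}.
     {a. bdd_above (range (\<lambda>(n, k). norm (E_mat r s t a n k / of_nat L) powr p k))})"

definition conj_exp :: "(nat \<Rightarrow> real) \<Rightarrow> nat \<Rightarrow> real" where
  "conj_exp p k = p k / (p k - 1)"

definition Gamma5 ::
  "(nat \<Rightarrow> 'a::real_normed_field) \<Rightarrow> (nat \<Rightarrow> 'a) \<Rightarrow> (nat \<Rightarrow> 'a) \<Rightarrow> (nat \<Rightarrow> real) \<Rightarrow> (nat \<Rightarrow> 'a) set" where
  "Gamma5 r s t p = (\<Union>L\<in>{1::nat..}.
     {a. bdd_above (range (\<lambda>n. \<Sum>k. norm (E_mat r s t a n k / of_nat L) powr conj_exp p k))})"

end

theory Submission
  imports Defs "HOL-Computational_Algebra.Formal_Power_Series"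
begin

text \<open>
  Convolution with \<open>s\<close> is multiplication of generating functions, and \<open>(-1)^n D_n\<close> are the
  coefficients of \<open>1 / (\<Sum> s_n X^n)\<close>. Hence the difference-mean transform \<open>x \<mapsto> y\<close> is a bijection of
  the space of all sequences, and summation by parts gives
  \<open>\<Sum>_{k\<le>n} a_k x_k = \<Sum>_{k\<le>n} e_{nk} y_k\<close>. The \<open>\<gamma>\<close>-dual thus consists of those \<open>a\<close> whose triangular
  matrix \<open>E\<close> maps the Maddox space into the bounded sequences. Sufficiency of each condition on \<open>E\<close>
  is a termwise estimate; for necessity, a gliding hump turns a failure of the condition into a
  sequence of the space with an unbounded image.
\<close>

subsection \<open>Inversion of the transform\<close>

text \<open>Cramer's rule for the lower triangular Toeplitz matrix \<open>M\<close> of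
  \<open>s\<close>: the reciprocal series has coefficients \<open>c\<close> with
  \<open>M c = e_0\<close>. Multiplying by the adjugate turns \<open>det M * c n\<close> into the
  cofactor at \<open>(0, n)\<close>, whose minor is the determinant in
  \<open>Dcoeff\<close>.\<close>

lemma Toeplitz_minor_eq_inverse_coeff:
  fixes s :: "nat \<Rightarrow> 'a::field"
  assumes s0: "s 0 \<noteq> 0"
  shows "(- 1) ^ n * det (mat n n (\<lambda>(i, j). if j \<le> i + 1 then s (i + 1 - j) else 0))
         = s 0 ^ (n + 1) * fps_nth (inverse (Abs_fps s)) n"
proof -
  define c where "c = fps_nth (inverse (Abs_fps s))"
  define M where "M = mat (Suc n) (Suc n) (\<lambda>(i, j). if j \<le> i then s (i - j) else 0)"
  define v where "v = vec (Suc n) c"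
  have M: "M \<in> carrier_mat (Suc n) (Suc n)" and v: "v \<in> carrier_vec (Suc n)"
    by (auto simp: M_def v_def)
  have "inverse (Abs_fps s) * Abs_fps s = 1"
    using s0 by (intro inverse_mult_eq_1) simp
  then have "fps_nth (inverse (Abs_fps s) * Abs_fps s) i = fps_nth 1 i" for i
    by simp
  then have conv: "(\<Sum>j\<le>i. c j * s (i - j)) = (if i = 0 then 1 else 0)" for i
    by (simp add: c_def fps_mult_nth atLeast0AtMost)
  have "M *\<^sub>v v = unit_vec (Suc n) 0"
  proof (rule eq_vecI)
    fix i assume "i < dim_vec (unit_vec (Suc n) 0 :: 'a vec)"
    then have i: "i < Suc n" by simp
    have "(M *\<^sub>v v) $ i = (\<Sum>j<Suc n. if j \<le> i then c j * s (i - j) else 0)"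
      using i by (auto simp: M_def v_def scalar_prod_def atLeast0LessThan intro!: sum.cong)
    also have "\<dots> = (\<Sum>j\<le>i. c j * s (i - j))"
      using i by (intro sum.mono_neutral_cong_right) auto
    finally show "(M *\<^sub>v v) $ i = unit_vec (Suc n) 0 $ i"
      using i conv[of i] by (simp add: unit_vec_def)
  qed (use M in auto)
  then have "adj_mat M *\<^sub>v unit_vec (Suc n) 0 = (adj_mat M * M) *\<^sub>v v"
    using assoc_mult_mat_vec[OF adj_mat(1)[OF M] M v] by simp
  also have "\<dots> = det M \<cdot>\<^sub>v v"
    unfolding adj_mat(3)[OF M] using v by (intro eq_vecI) auto
  finally have "(adj_mat M *\<^sub>v unit_vec (Suc n) 0) $ n = det M * c n"
    by (simp add: v_def)
  moreover have "(adj_mat M *\<^sub>v unit_vec (Suc n) 0) $ n = cofactor M 0 n"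
    using adj_mat(1)[OF M] M by (simp add: adj_mat_def)
  moreover have "det M = s 0 ^ Suc n"
  proof -
    have "det M = prod_list (diag_mat M)"
      using M by (intro det_lower_triangular[of "Suc n"]) (auto simp: M_def)
    also have "\<dots> = s 0 ^ Suc n"
      using M by (simp add: prod_list_diag_prod M_def)
    finally show ?thesis .
  qed
  \<comment> \<open>Deleting row 0 shifts the row index by one, so \<open>s (i - j)\<close> becomes
    \<open>s (i + 1 - j)\<close>; the deleted column is the last one, so column indices
    stay.\<close>
  moreover have "mat_delete M 0 n = mat n n (\<lambda>(i, j). if j \<le> i + 1 then s (i + 1 - j) else 0)"
    by (rule eq_matI) (auto simp: mat_delete_def M_def)
  ultimately show ?thesis
    by (simp add: c_def cofactor_def)
qed

lemma Dcoeff_eq_inverse_coeff: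
  fixes s :: "nat \<Rightarrow> 'a::real_normed_field"
  assumes s0: "s 0 \<noteq> 0"
  shows "(- 1) ^ n * Dcoeff s n = fps_nth (inverse (Abs_fps s)) n"
proof (cases "n = 0")
  case False
  then have "(- 1) ^ n * Dcoeff s n = 1 / s 0 ^ (n + 1) *
      ((- 1) ^ n * det (mat n n (\<lambda>(i, j). if j \<le> i + 1 then s (i + 1 - j) else 0)))"
    by (simp add: Dcoeff_def)
  also have "\<dots> = fps_nth (inverse (Abs_fps s)) n"
    unfolding Toeplitz_minor_eq_inverse_coeff[where s = s, OF s0] using s0 by simp
  finally show ?thesis .
qed (simp add: Dcoeff_def field_simps)

text \<open>\<open>E_mat\<close> lists the terms \<open>l = k\<close> and \<open>l = k + 1\<close>
  of one sum separately; here they are put back. The term \<open>l = k\<close> accounts for both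
  \<open>a k / (s 0 * t k)\<close> and the part with \<open>Dcoeff s 0\<close>.\<close>

lemma E_mat_eq:
  fixes r s t a :: "nat \<Rightarrow> 'a::real_normed_field"
  assumes s0: "s 0 \<noteq> 0" and kn: "k \<le> n"
  shows "E_mat r s t a n k =
    r k * (\<Sum>l=k..n. fps_nth (inverse (Abs_fps s)) (l - k) / t l * (\<Sum>j=l..n. a j))"
proof -
  define c where "c = fps_nth (inverse (Abs_fps s))"
  have c: "(- 1) ^ m * Dcoeff s m = c m" for m
    using Dcoeff_eq_inverse_coeff[of s m] s0 by (simp add: c_def)
  let ?f = "\<lambda>l. c (l - k) / t l * (\<Sum>j=l..n. a j)"
  have c0: "Dcoeff s 0 = c 0" "c 0 = 1 / s 0" and c1: "Dcoeff s 1 = - c 1"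
    using c[of 0] c[of 1, symmetric] by (simp_all add: Dcoeff_def)
  have "(\<Sum>l=k..n. ?f l) = ?f k + (\<Sum>l=Suc k..n. ?f l)"
    using kn by (rule sum.atLeast_Suc_atMost)
  also have "(\<Sum>l=Suc k..n. ?f l) = ?f (Suc k) + (\<Sum>l=k+2..n. ?f l)"
    \<comment> \<open>For \<open>k = n\<close> the term split off is zero, because its inner sum
      over \<open>a\<close> is empty.\<close>
    by (cases "k = n") (use kn in \<open>simp_all add: sum.atLeast_Suc_atMost\<close>)
  also have "(\<Sum>l=k+2..n. ?f l)
      = (\<Sum>l=k+2..n. (- 1) ^ (l - k) * (Dcoeff s (l - k) / t l) * (\<Sum>j=l..n. a j))"
    by (simp add: c[symmetric])
  also have "?f k = a k / (s 0 * t k) + c 0 / t k * (\<Sum>j=k+1..n. a j)"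
    using kn by (simp add: sum.atLeast_Suc_atMost c0 distrib_left add_divide_distrib)
  finally show ?thesis
    using kn by (simp add: E_mat_def c_def[symmetric] c0(1) c1[simplified] algebra_simps)
qed

section \<open>Summation by parts and reduction of the duals to matrix conditions\<close>

lemma sum_triangle_swap:
  fixes f :: "nat \<Rightarrow> nat \<Rightarrow> 'b::comm_monoid_add"
  shows "(\<Sum>j\<le>n. \<Sum>l\<le>j. f j l) = (\<Sum>l\<le>n. \<Sum>j=l..n. f j l)"
  by (induction n) (auto simp: sum.distrib)

lemma sum_backward_diff: "(\<Sum>k\<le>n. backward_diff x k) = x n"
  by (induction n) (auto simp: backward_diff_def)

lemma backward_diff_sum: "backward_diff (\<lambda>n. \<Sum>k\<le>n. f k) k = f k"
  by (cases k) (auto simp: backward_diff_def)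

text \<open>Both sides say that the generating function of \<open>d\<close> times that of \<open>s\<close> is that of \<open>z\<close>.\<close>
lemma convolution_eq_iff:
  fixes s d z :: "nat \<Rightarrow> 'a::field"
  assumes s0: "s 0 \<noteq> 0"
  shows "(\<forall>n. (\<Sum>k=0..n. s (n - k) * d k) = z n) \<longleftrightarrow>
         (\<forall>n. d n = (\<Sum>k\<le>n. fps_nth (inverse (Abs_fps s)) (n - k) * z k))"
proof -
  have "(\<forall>n. (\<Sum>k=0..n. s (n - k) * d k) = z n) \<longleftrightarrow> Abs_fps d * Abs_fps s = Abs_fps z"
    unfolding fps_eq_iff fps_mult_nth fps_nth_Abs_fps mult.commute[of "d _"] ..
  also have "\<dots> \<longleftrightarrow> Abs_fps d = Abs_fps z * inverse (Abs_fps s)"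
  proof -
    have "fps_nth (Abs_fps s) 0 \<noteq> 0"
      using s0 by simp
    note inv = inverse_mult_eq_1[OF this] inverse_mult_eq_1'[OF this]
    show ?thesis
    proof
      assume "Abs_fps d * Abs_fps s = Abs_fps z"
      then have "Abs_fps z * inverse (Abs_fps s) = Abs_fps d * (Abs_fps s * inverse (Abs_fps s))"
        by (simp only: mult.assoc[symmetric])
      then show "Abs_fps d = Abs_fps z * inverse (Abs_fps s)"
        by (simp only: inv mult_1_right)
    next
      assume "Abs_fps d = Abs_fps z * inverse (Abs_fps s)"
      then show "Abs_fps d * Abs_fps s = Abs_fps z"
        by (simp only: mult.assoc inv mult_1_right)
    qed
  qed
  also have "\<dots> \<longleftrightarrow> (\<forall>n. d n = (\<Sum>k\<le>n. fps_nth (inverse (Abs_fps s)) (n - k) * z k))"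
    unfolding fps_eq_iff fps_mult_nth fps_nth_Abs_fps mult.commute[of "z _"] atLeast0AtMost ..
  finally show ?thesis .
qed

text \<open>Writing \<open>x j\<close> as the sum of its differences and exchanging sums attaches
  the tail \<open>a l + ... + a n\<close> to the \<open>l\<close>-th difference. Expanding the
  differences in terms of \<open>y\<close> and exchanging once more collects the coefficient of
  \<open>y k\<close>, which is the matrix entry.\<close>

lemma sum_E_mat:
  fixes r s t a x y :: "nat \<Rightarrow> 'a::real_normed_field"
  assumes r: "\<forall>n. r n \<noteq> 0" and t: "\<forall>n. t n \<noteq> 0" and s0: "s 0 \<noteq> 0"
    and y: "\<And>n. y n = 1 / r n * (\<Sum>k=0..n. s (n - k) * t k * backward_diff x k)"
  shows "(\<Sum>k=0..n. a k * x k) = (\<Sum>k\<le>n. E_mat r s t a n k * y k)"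
proof -
  define c where "c = fps_nth (inverse (Abs_fps s))"
  \<comment> \<open>Clearing \<open>r n\<close> exhibits the transform as a convolution of
    \<open>s\<close> with \<open>t * \<Delta>x\<close>, which the reciprocal series inverts.\<close>
  have "\<forall>n. (\<Sum>k=0..n. s (n - k) * (t k * backward_diff x k)) = r n * y n"
    using r by (simp add: y mult.assoc)
  then have "t n * backward_diff x n = (\<Sum>k\<le>n. c (n - k) * (r k * y k))" for n
    using convolution_eq_iff[where s = s and d = "\<lambda>k. t k * backward_diff x k"
        and z = "\<lambda>k. r k * y k", OF s0]
    unfolding c_def by blast
  then have d: "backward_diff x l = (\<Sum>k\<le>l. c (l - k) * (r k * y k)) / t l" for l
    using t by (metis nonzero_mult_div_cancel_left)
  have "(\<Sum>j=0..n. a j * x j) = (\<Sum>j\<le>n. \<Sum>l\<le>j. a j * backward_diff x l)"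
    by (simp add: sum_distrib_left[symmetric] sum_backward_diff atLeast0AtMost)
  also have "\<dots> = (\<Sum>l\<le>n. \<Sum>j=l..n. a j * backward_diff x l)"
    by (rule sum_triangle_swap)
  also have "\<dots> = (\<Sum>l\<le>n. \<Sum>k\<le>l. c (l - k) / t l * (\<Sum>j=l..n. a j) * (r k * y k))"
  proof (rule sum.cong[OF refl])
    fix l
    define A where "A = (\<Sum>j=l..n. a j)"
    have "(\<Sum>j=l..n. a j * backward_diff x l) = A * backward_diff x l"
      by (simp add: A_def sum_distrib_right)
    also have "\<dots> = (\<Sum>k\<le>l. c (l - k) / t l * A * (r k * y k))"
      by (simp add: d sum_distrib_left sum_divide_distrib mult_ac)
    finally show "(\<Sum>j=l..n. a j * backward_diff x l) =
        (\<Sum>k\<le>l. c (l - k) / t l * (\<Sum>j=l..n. a j) * (r k * y k))"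
      by (simp add: A_def)
  qed
  also have "\<dots> = (\<Sum>k\<le>n. \<Sum>l=k..n. c (l - k) / t l * (\<Sum>j=l..n. a j) * (r k * y k))"
    by (rule sum_triangle_swap)
  also have "\<dots> = (\<Sum>k\<le>n. E_mat r s t a n k * y k)"
    by (simp add: E_mat_eq[where s = s, OF s0] c_def[symmetric] sum_distrib_left sum_distrib_right mult_ac)
  finally show ?thesis .
qed

text \<open>The transform is onto all sequences, so testing \<open>a\<close> against the difference
  space amounts to testing the matrix against every \<open>y\<close> in \<open>X\<close>. This
  leaves a question about triangular matrices only.\<close>

lemma gamma_dual_mean_diff_space:
  fixes r s t :: "nat \<Rightarrow> 'a::real_normed_field"
  assumes r: "\<forall>n. r n \<noteq> 0" and t: "\<forall>n. t n \<noteq> 0" and s0: "s 0 \<noteq> 0"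
  shows "gamma_dual (mean_diff_space X r s t) =
    {a. \<forall>y\<in>X. Bseq (\<lambda>n. \<Sum>k\<le>n. E_mat r s t a n k * y k)}"
proof (intro equalityI subsetI CollectI ballI)
  fix a y assume a: "a \<in> gamma_dual (mean_diff_space X r s t)" and yX: "y \<in> X"
  \<comment> \<open>Preimage of \<open>y\<close>: \<open>d\<close> is the quotient of
    \<open>r * y\<close> by \<open>s\<close> as power series and plays the role of
    \<open>t * \<Delta>x\<close>; summing \<open>d / t\<close> undoes the difference.\<close>
  define d where "d = (\<lambda>n. \<Sum>k\<le>n. fps_nth (inverse (Abs_fps s)) (n - k) * (r k * y k))"
  define x where "x = (\<lambda>n. \<Sum>k\<le>n. d k / t k)"
  have conv: "(\<Sum>k=0..n. s (n - k) * d k) = r n * y n" for n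
    using convolution_eq_iff[where s = s and d = d and z = "\<lambda>n. r n * y n", OF s0]
    unfolding d_def by blast
  have td: "t k * backward_diff x k = d k" for k
    using t by (simp add: x_def backward_diff_sum)
  have y: "y n = 1 / r n * (\<Sum>k=0..n. s (n - k) * t k * backward_diff x k)" for n
    unfolding mult.assoc td conv using r by simp
  have y_eq: "(\<lambda>n. 1 / r n * (\<Sum>k=0..n. s (n - k) * t k * backward_diff x k)) = y"
    by (rule ext) (rule y[symmetric])
  have "x \<in> mean_diff_space X r s t"
    unfolding mean_diff_space_def mem_Collect_eq y_eq by (rule yX)
  then have "Bseq (\<lambda>n. \<Sum>k=0..n. a k * x k)"
    using a unfolding gamma_dual_def bs_def by blast
  moreover have "(\<Sum>k=0..n. a k * x k) = (\<Sum>k\<le>n. E_mat r s t a n k * y k)" for n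
    by (rule sum_E_mat[OF r t s0 y])
  ultimately show "Bseq (\<lambda>n. \<Sum>k\<le>n. E_mat r s t a n k * y k)"
    by (simp only:)
next
  fix a assume a: "a \<in> {a. \<forall>y\<in>X. Bseq (\<lambda>n. \<Sum>k\<le>n. E_mat r s t a n k * y k)}"
  show "a \<in> gamma_dual (mean_diff_space X r s t)"
    unfolding gamma_dual_def bs_def
  proof (intro CollectI ballI)
    fix x assume x: "x \<in> mean_diff_space X r s t"
    define y where
      "y = (\<lambda>n. 1 / r n * (\<Sum>k=0..n. s (n - k) * t k * backward_diff x k))"
    have y: "y n = 1 / r n * (\<Sum>k=0..n. s (n - k) * t k * backward_diff x k)" for n
      by (simp only: y_def)
    have "y \<in> X"
      using x unfolding mean_diff_space_def mem_Collect_eq y_def .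
    then have "Bseq (\<lambda>n. \<Sum>k\<le>n. E_mat r s t a n k * y k)"
      by (rule bspec[OF CollectD[OF a]])
    moreover have "(\<Sum>k=0..n. a k * x k) = (\<Sum>k\<le>n. E_mat r s t a n k * y k)" for n
      by (rule sum_E_mat[OF r t s0 y])
    ultimately show "Bseq (\<lambda>n. \<Sum>k=0..n. a k * x k)"
      by (simp only:)
  qed
qed

subsection \<open>The gliding hump\<close>

lemma suminf_triangle:
  fixes f :: "nat \<Rightarrow> 'b::{comm_monoid_add,t2_space}"
  assumes "\<And>k. n < k \<Longrightarrow> f k = 0"
  shows "suminf f = (\<Sum>k\<le>n. f k)"
  using assms by (intro suminf_finite) auto

text \<open>The first block end beyond \<open>k\<close>, searched from \<open>m\<close> on, locates
  \<open>k\<close>; it exists since \<open>K i\<close> is at least \<open>i\<close>.\<close>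

lemma strict_mono_block:
  fixes K :: "nat \<Rightarrow> nat"
  assumes K: "strict_mono K" and k: "K m \<le> k"
  obtains i where "m \<le> i" "k \<in> {K i..<K (Suc i)}"
proof -
  define P where "P j \<longleftrightarrow> k < K (m + j)" for j
  have "k \<le> K k" using K by (rule strict_mono_imp_increasing)
  also have "K k < K (m + Suc k)" using K by (simp add: strict_mono_def)
  finally have "P (Suc k)" by (simp add: P_def)
  moreover have "\<not> P 0" using k by (simp add: P_def)
  ultimately obtain j where "\<forall>i\<le>j. \<not> P i" "P (Suc j)"
    using ex_least_nat_less[of P] by blast
  then show ?thesis
    by (intro that[of "m + j"]) (auto simp: P_def not_less)
qed

text \<open>\<open>P m I z\<close> expresses that \<open>z\<close> is admissible on the block
  \<open>I\<close> at stage \<open>m\<close>; by \<open>cong\<close> it depends only on the values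
  on \<open>I\<close>. Blocks are appended one by one: bounded columns keep the contribution of the
  earlier blocks below a constant in every row, and the next hump is chosen to exceed that constant
  by \<open>m\<close>.\<close>

lemma gliding_hump:
  fixes A :: "nat \<Rightarrow> nat \<Rightarrow> 'a::real_normed_field"
    and P :: "nat \<Rightarrow> nat set \<Rightarrow> (nat \<Rightarrow> 'a) \<Rightarrow> bool"
  assumes col: "\<And>k. Bseq (\<lambda>n. A n k)"
    and cong: "\<And>m I z z'. P m I z \<Longrightarrow> (\<And>k. k \<in> I \<Longrightarrow> z k = z' k) \<Longrightarrow> P m I z'"
    and hump: "\<And>m K B. \<exists>n z. K \<le> n \<and> P m {K..n} z \<and> B \<le> norm (\<Sum>k=K..n. A n k * z k)"
  obtains y K where "strict_mono K" "K 0 = 0" "\<And>m. P m {K m..<K (Suc m)} y"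
    "\<not> Bseq (\<lambda>n. \<Sum>k\<le>n. A n k * y k)"
proof -
  \<comment> \<open>A state is a length and a sequence of which only the entries below that length
    are final. A step keeps them, appends an admissible block, and makes the row indexed by the last
    new position have a sum of norm at least \<open>m\<close>.\<close>
  define R where "R m s s' \<longleftrightarrow> fst s < fst s' \<and> (\<forall>k<fst s. snd s' k = snd s k) \<and>
      P m {fst s..<fst s'} (snd s') \<and> real m \<le> norm (\<Sum>k<fst s'. A (fst s' - 1) k * snd s' k)"
    for m :: nat and s s' :: "nat \<times> (nat \<Rightarrow> 'a)"
  have step: "\<exists>s'. R m s s'" for m s
  proof -
    obtain K y where s: "s = (K, y)" by (cases s)
    have "\<exists>C. \<forall>n. norm (A n k * y k) \<le> C" for k
    proof -
      obtain C where "\<And>n. norm (A n k) \<le> C"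
        using col[of k] by (auto simp: Bseq_def)
      then show ?thesis
        by (intro exI[of _ "C * norm (y k)"] allI) (auto simp: norm_mult intro: mult_right_mono)
    qed
    then have "\<exists>C. \<forall>k n. norm (A n k * y k) \<le> C k"
      by (intro choice allI)
    then obtain C where C: "\<And>k n. norm (A n k * y k) \<le> C k"
      by blast
    obtain n z where n: "K \<le> n" and Pz: "P m {K..n} z"
      and large: "real m + (\<Sum>k<K. C k) \<le> norm (\<Sum>k=K..n. A n k * z k)"
      using hump[of K m "real m + (\<Sum>k<K. C k)"] by blast
    define y' where "y' k = (if k < K then y k else z k)" for k
    have "(\<Sum>k<Suc n. A n k * y' k) = (\<Sum>k<K. A n k * y' k) + (\<Sum>k=K..<Suc n. A n k * y' k)"
      using n sum.atLeastLessThan_concat[of 0 K "Suc n" "\<lambda>k. A n k * y' k"]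
      by (simp add: atLeast0LessThan)
    also have "(\<Sum>k<K. A n k * y' k) = (\<Sum>k<K. A n k * y k)"
      by (simp add: y'_def)
    also have "(\<Sum>k=K..<Suc n. A n k * y' k) = (\<Sum>k=K..n. A n k * z k)"
      by (intro sum.cong) (auto simp: y'_def)
    finally have split: "(\<Sum>k<Suc n. A n k * y' k) = (\<Sum>k<K. A n k * y k) + (\<Sum>k=K..n. A n k * z k)" .
    have "norm (\<Sum>k<K. A n k * y k) \<le> (\<Sum>k<K. C k)"
      by (rule sum_norm_le) (rule C)
    then have "real m \<le> norm (\<Sum>k<Suc n. A n k * y' k)"
      using large norm_triangle_ineq2[of "\<Sum>k=K..n. A n k * z k" "- (\<Sum>k<K. A n k * y k)"]
      unfolding split by (simp add: add.commute)
    moreover have "P m {K..<Suc n} y'"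
      by (rule cong[of m _ z]) (use Pz in \<open>auto simp: y'_def atLeastLessThanSuc_atLeastAtMost\<close>)
    ultimately have "R m s (Suc n, y')"
      using n by (simp add: R_def s y'_def)
    then show ?thesis ..
  qed
  have "\<exists>\<sigma>. \<forall>m. (m = 0 \<longrightarrow> fst (\<sigma> m) = 0) \<and> R m (\<sigma> m) (\<sigma> (Suc m))"
    by (rule dependent_nat_choice) (use step in auto)
  then obtain \<sigma> where \<sigma>0: "fst (\<sigma> 0) = 0" and \<sigma>: "\<And>m. R m (\<sigma> m) (\<sigma> (Suc m))"
    by blast
  define K where "K m = fst (\<sigma> m)" for m
  \<comment> \<open>Entry \<open>k\<close> is read from state \<open>k + 1\<close>, whose length
    already exceeds \<open>k\<close>; any other state of length above \<open>k\<close> agrees with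
    it there.\<close>
  define y where "y k = snd (\<sigma> (Suc k)) k" for k
  have K: "strict_mono K"
    using \<sigma> by (auto simp: strict_mono_Suc_iff R_def K_def)
  have stable: "snd (\<sigma> j) k = snd (\<sigma> i) k" if "i \<le> j" "k < K i" for i j k
    using that(1)
  proof (induction rule: dec_induct)
    case (step j)
    have "K i \<le> K j"
      using K step.hyps by (simp add: strict_mono_less_eq)
    then show ?case
      using \<sigma>[of j] step.IH that(2) by (auto simp: R_def K_def)
  qed simp
  have y: "y k = snd (\<sigma> m) k" if "k < K m" for k m
  proof -
    have "Suc k \<le> K (Suc k)"
      using K by (rule strict_mono_imp_increasing)
    then have "k < K (Suc k)" by simp
    with that show ?thesis
      unfolding y_def by (metis linear stable)
  qed
  show ?thesis
  proof
    show "strict_mono K" by (rule K)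
    show "K 0 = 0" using \<sigma>0 by (simp add: K_def)
    show "P m {K m..<K (Suc m)} y" for m
      by (rule cong[of m _ "snd (\<sigma> (Suc m))"])
        (use \<sigma>[of m] y[of _ "Suc m"] in \<open>auto simp: R_def K_def\<close>)
    show "\<not> Bseq (\<lambda>n. \<Sum>k\<le>n. A n k * y k)"
    proof
      assume "Bseq (\<lambda>n. \<Sum>k\<le>n. A n k * y k)"
      then obtain b where b: "\<And>n. norm (\<Sum>k\<le>n. A n k * y k) \<le> b"
        by (auto simp: Bseq_def)
      obtain m :: nat where m: "b < real m"
        using reals_Archimedean2 by blast
      \<comment> \<open>The last index of the half-open block is also the row in which its hump was
        produced.\<close>
      define n where "n = K (Suc m) - 1"
      have Kn: "K (Suc m) = Suc n"
        using \<sigma>[of m] by (simp add: n_def K_def R_def)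
      have "real m \<le> norm (\<Sum>k<K (Suc m). A n k * snd (\<sigma> (Suc m)) k)"
        using \<sigma>[of m] by (simp add: n_def K_def R_def)
      also have "(\<Sum>k<K (Suc m). A n k * snd (\<sigma> (Suc m)) k) = (\<Sum>k\<le>n. A n k * y k)"
        using y[of _ "Suc m"] by (intro sum.cong) (auto simp: Kn)
      finally show False using b[of n] m by simp
    qed
  qed
qed

text \<open>The quotient \<open>of_real (norm a) / a\<close> replaces the conjugate phase and needs
  only a multiplicative norm.\<close>

lemma unimodular_factor:
  fixes a :: "'a::real_normed_field"
  obtains u where "norm u = 1" "a * u = of_real (norm a)"
proof (cases "a = 0")
  case True
  then show ?thesis by (intro that[of 1]) auto
next
  case False
  then show ?thesis by (intro that[of "of_real (norm a) / a"]) (auto simp: norm_divide)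
qed

section \<open>Elementary inequalities for powers\<close>

lemma powr_inverse_exponent_le_iff:
  fixes x c p :: real
  assumes "0 < p" "0 \<le> x" "0 < c"
  shows "x powr p \<le> c \<longleftrightarrow> x \<le> c powr (1 / p)"
proof
  assume "x powr p \<le> c"
  then have "(x powr p) powr (1 / p) \<le> c powr (1 / p)"
    using assms by (intro powr_mono2) auto
  then show "x \<le> c powr (1 / p)"
    using assms by (simp add: powr_powr)
next
  assume "x \<le> c powr (1 / p)"
  then have "x powr p \<le> (c powr (1 / p)) powr p"
    using assms by (intro powr_mono2) auto
  then show "x powr p \<le> c"
    using assms by (simp add: powr_powr)
qed

text \<open>Weak form of Young's inequality: one of the two powers already dominates the product.\<close>
lemma mult_le_powr_add_powr:
  fixes u v p :: real
  assumes p: "1 < p" and "0 \<le> u" "0 \<le> v"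
  shows "u * v \<le> u powr (p / (p - 1)) + v powr p"
proof (cases "u = 0 \<or> v = 0")
  case False
  then have u: "0 < u" and v: "0 < v" using assms by auto
  have q: "p / (p - 1) = 1 + 1 / (p - 1)" using p by (simp add: field_simps)
  show ?thesis
  \<comment> \<open>At equality the product and both powers coincide; below this threshold the power
    of \<open>u\<close> dominates, above it the power of \<open>v\<close>.\<close>
  proof (cases "v \<le> u powr (1 / (p - 1))")
    case True
    then have "u * v \<le> u * u powr (1 / (p - 1))" using u by simp
    also have "\<dots> = u powr (p / (p - 1))" using u by (simp add: q powr_add)
    finally show ?thesis using powr_ge_zero[of v p] by linarith
  next
    case False
    then have "(u powr (1 / (p - 1))) powr (p - 1) \<le> v powr (p - 1)"
      using p by (intro powr_mono2) auto
    then have "u \<le> v powr (p - 1)" using u p by (simp add: powr_powr)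
    then have "u * v \<le> v powr (p - 1) * v" using v by simp
    also have "\<dots> = v powr p" using v powr_add[of v "p - 1" 1] by simp
    finally show ?thesis using powr_ge_zero[of u "p / (p - 1)"] by linarith
  qed
qed auto

subsection \<open>Triangular matrices mapping Maddox spaces into the bounded sequences\<close>

lemma maddox_l_subset_c0: "maddox_l p \<subseteq> maddox_c0 p"
  by (auto simp: maddox_l_def maddox_c0_def summable_LIMSEQ_zero)

lemma maddox_c0_subset_linf: "maddox_c0 p \<subseteq> maddox_linf p"
proof
  fix x :: "nat \<Rightarrow> 'a" assume "x \<in> maddox_c0 p"
  then have "Bseq (\<lambda>k. norm (x k) powr p k)"
    by (intro convergent_imp_Bseq) (auto simp: maddox_c0_def convergent_def)
  then show "x \<in> maddox_linf p"
    by (auto simp: maddox_linf_def Bseq_def bdd_above_def)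
qed

lemma unit_vector_in_maddox_l:
  "(\<lambda>k. if k = j then 1 else 0 :: 'a::real_normed_field) \<in> maddox_l p"
proof -
  have "summable (\<lambda>k. norm (if k = j then 1 else 0 :: 'a) powr p k)"
    by (rule summable_finite[of "{j}"]) auto
  then show ?thesis by (simp add: maddox_l_def)
qed

text \<open>Testing on the \<open>j\<close>-th unit vector supplies the bounded columns that the
  gliding hump requires.\<close>

lemma column_Bseq:
  fixes A :: "nat \<Rightarrow> nat \<Rightarrow> 'a::real_normed_field"
  assumes tri: "\<And>n k. n < k \<Longrightarrow> A n k = 0"
    and X: "maddox_l p \<subseteq> X" and bd: "\<forall>y\<in>X. Bseq (\<lambda>n. \<Sum>k\<le>n. A n k * y k)"
  shows "Bseq (\<lambda>n. A n j)"
proof -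
  have "(\<lambda>k. if k = j then 1 else 0) \<in> X"
    using unit_vector_in_maddox_l X by blast
  then have "Bseq (\<lambda>n. \<Sum>k\<le>n. A n k * (if k = j then 1 else 0))"
    by (rule bspec[OF bd])
  moreover have "(\<Sum>k\<le>n. A n k * (if k = j then 1 else 0)) = A n j" for n
    using tri[of n j] by (cases "j \<le> n") (auto simp: if_distrib cong: if_cong)
  ultimately show ?thesis by simp
qed

text \<open>The first \<open>K\<close> columns contribute a bounded amount to every row, so
  unbounded row sums must come from arbitrarily late columns.\<close>

lemma unbounded_row_tail:
  fixes f :: "nat \<Rightarrow> nat \<Rightarrow> real"
  assumes nonneg: "\<And>n k. 0 \<le> f n k" and col: "\<And>k. bdd_above (range (\<lambda>n. f n k))"
    and unbdd: "\<not> bdd_above (range (\<lambda>n. \<Sum>k\<le>n. f n k))"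
  obtains n where "K \<le> n" "B \<le> (\<Sum>k=K..n. f n k)"
proof -
  have "\<forall>k. \<exists>g. \<forall>n. f n k \<le> g"
    using col by (auto simp: bdd_above_def)
  then obtain g where g: "\<And>n k. f n k \<le> g k"
    by metis
  \<comment> \<open>The maximum with 0 forces \<open>K \<le> n\<close> even for negative
    \<open>B\<close>: a shorter row would be bounded by the head.\<close>
  have "\<exists>n. max B 0 + (\<Sum>k<K. g k) < (\<Sum>k\<le>n. f n k)"
    using unbdd by (auto simp: bdd_above_def not_le)
  then obtain n where n: "max B 0 + (\<Sum>k<K. g k) < (\<Sum>k\<le>n. f n k)" ..
  have head: "(\<Sum>k<K. f n k) \<le> (\<Sum>k<K. g k)"
    by (rule sum_mono) (rule g)
  have "K \<le> n"
  proof (rule ccontr)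
    assume "\<not> K \<le> n"
    then have "(\<Sum>k\<le>n. f n k) \<le> (\<Sum>k<K. f n k)"
      by (intro sum_mono2) (auto simp: nonneg)
    then show False using n head by linarith
  qed
  moreover have "(\<Sum>k\<le>n. f n k) = (\<Sum>k<K. f n k) + (\<Sum>k=K..n. f n k)"
    using \<open>K \<le> n\<close> sum.atLeastLessThan_concat[of 0 K "Suc n" "f n"]
    by (simp add: atLeast0LessThan atLeastLessThanSuc_atLeastAtMost atLeast0AtMost)
  ultimately show ?thesis
    using n head by (intro that[of n]) auto
qed

text \<open>Unimodular factors make all products \<open>a k * z k\<close> nonnegative reals, so the
  triangle inequality becomes an equality for every \<open>I\<close> at once.\<close>

lemma aligned_vector:
  fixes a :: "nat \<Rightarrow> 'a::real_normed_field"
  assumes w: "\<And>k. 0 \<le> w k"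
  obtains z where "\<And>k. norm (z k) = w k"
    "\<And>I. norm (\<Sum>k\<in>I. a k * z k) = (\<Sum>k\<in>I. norm (a k) * w k)"
proof -
  have "\<forall>k. \<exists>u. norm u = 1 \<and> a k * u = of_real (norm (a k))"
    by (metis unimodular_factor)
  then obtain u where u: "\<And>k. norm (u k) = 1" "\<And>k. a k * u k = of_real (norm (a k))"
    by metis
  show ?thesis
  proof
    show "norm (u k * of_real (w k)) = w k" for k
      using w by (simp add: norm_mult u)
    have "(\<Sum>k\<in>I. a k * (u k * of_real (w k))) = of_real (\<Sum>k\<in>I. norm (a k) * w k)" for I
      by (simp add: mult.assoc[symmetric] u)
    moreover have "0 \<le> (\<Sum>k\<in>I. norm (a k) * w k)" for I
      using w by (simp add: sum_nonneg)
    ultimately show "norm (\<Sum>k\<in>I. a k * (u k * of_real (w k))) = (\<Sum>k\<in>I. norm (a k) * w k)" for I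
      by (simp only: norm_of_real abs_of_nonneg)
  qed
qed

lemma bdd_above_norm_mult_column:
  fixes A :: "nat \<Rightarrow> nat \<Rightarrow> 'a::real_normed_field"
  assumes "Bseq (\<lambda>n. A n k)" "0 \<le> w"
  shows "bdd_above (range (\<lambda>n. norm (A n k) * w))"
proof -
  obtain b where "\<And>n. norm (A n k) \<le> b"
    using assms(1) by (auto simp: Bseq_def)
  then show ?thesis
    using assms(2) by (intro bdd_aboveI2[where M = "b * w"] mult_right_mono)
qed

section \<open>Matrix conditions for c0(p), linf(p) and c(p)\<close>

text \<open>The weight \<open>L powr (- 1 / p k)\<close> is the modulus whose \<open>p k\<close>-th
  power is \<open>1 / L\<close>. If every \<open>L\<close> fails, block \<open>m\<close> uses
  \<open>L = m + 1\<close>, and the glued sequence lies in c0(p). Conversely, a member of c0(p) is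
  eventually below the weights of any fixed \<open>L\<close>.\<close>

lemma maddox_c0_bounded_iff:
  fixes A :: "nat \<Rightarrow> nat \<Rightarrow> 'a::real_normed_field"
  assumes tri: "\<And>n k. n < k \<Longrightarrow> A n k = 0" and p: "\<And>k. 0 < p k"
  shows "(\<forall>y\<in>maddox_c0 p. Bseq (\<lambda>n. \<Sum>k\<le>n. A n k * y k)) \<longleftrightarrow>
    (\<exists>L\<in>{1::nat..}. bdd_above (range (\<lambda>n. \<Sum>k\<le>n. norm (A n k) * real L powr (- 1 / p k))))"
    (is "?lhs \<longleftrightarrow> ?rhs")
proof
  assume bd: ?lhs
  show ?rhs
  proof (rule ccontr)
    assume unbdd: "\<not> ?rhs"
    have col: "Bseq (\<lambda>n. A n k)" for k
      using tri maddox_l_subset_c0 bd by (rule column_Bseq)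
    define P where "P m I z \<longleftrightarrow> (\<forall>k\<in>I. norm (z k) powr p k \<le> 1 / Suc m)"
      for m :: nat and I and z :: "nat \<Rightarrow> 'a"
    have hump: "\<exists>n z. K \<le> n \<and> P m {K..n} z \<and> B \<le> norm (\<Sum>k=K..n. A n k * z k)" for m K B
    proof -
      define w where "w k = real (Suc m) powr (- 1 / p k)" for k
      have "\<not> bdd_above (range (\<lambda>n. \<Sum>k\<le>n. norm (A n k) * w k))"
        unfolding w_def using unbdd by (auto dest!: bspec[of _ _ "Suc m"])
      then obtain n where n: "K \<le> n" "B \<le> (\<Sum>k=K..n. norm (A n k) * w k)"
        by (rule unbounded_row_tail[rotated 2])
          (auto simp: w_def intro: bdd_above_norm_mult_column col)
      obtain z where z: "\<And>k. norm (z k) = w k"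
        "\<And>I. norm (\<Sum>k\<in>I. A n k * z k) = (\<Sum>k\<in>I. norm (A n k) * w k)"
        by (rule aligned_vector[of w "A n"]) (auto simp: w_def)
      have "norm (z k) powr p k = 1 / Suc m" for k
        using p[of k] powr_minus_divide[of "real (Suc m)" 1] by (simp add: z w_def powr_powr)
      then have "P m {K..n} z" by (simp add: P_def)
      with n show ?thesis by (intro exI[of _ n] exI[of _ z]) (simp add: z(2))
    qed
    obtain y K where K: "strict_mono K" and y: "\<And>m. P m {K m..<K (Suc m)} y"
      and unb: "\<not> Bseq (\<lambda>n. \<Sum>k\<le>n. A n k * y k)"
      by (rule gliding_hump[where A = A and P = P, OF col _ hump]) (auto simp: P_def)
    have "y \<in> maddox_c0 p"
      unfolding maddox_c0_def mem_Collect_eq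
    proof (rule LIMSEQ_I)
      fix \<epsilon> :: real assume "0 < \<epsilon>"
      then obtain m where m: "1 / Suc m < \<epsilon>"
        using nat_approx_posE by blast
      have "norm (y k) powr p k < \<epsilon>" if k: "K m \<le> k" for k
      proof -
        obtain i where i: "m \<le> i" "k \<in> {K i..<K (Suc i)}"
          by (rule strict_mono_block[OF K k])
        have "norm (y k) powr p k \<le> 1 / real (Suc i)"
          using y[of i] i(2) by (auto simp: P_def)
        also have "\<dots> \<le> 1 / real (Suc m)"
          using i(1) by (simp add: frac_le)
        finally show ?thesis using m by linarith
      qed
      then show "\<exists>N. \<forall>k\<ge>N. norm (norm (y k) powr p k - 0) < \<epsilon>"
        by auto
    qed
    with bd unb show False by blast
  qed
next
  assume ?rhs
  then obtain L :: nat and b where L: "1 \<le> L"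
    and b: "\<And>n. (\<Sum>k\<le>n. norm (A n k) * real L powr (- 1 / p k)) \<le> b"
    by (auto simp: bdd_above_def)
  define w where "w k = real L powr (- 1 / p k)" for k
  have w: "0 < w k" for k using L by (simp add: w_def)
  show ?lhs
  proof
    fix y :: "nat \<Rightarrow> 'a" assume "y \<in> maddox_c0 p"
    then have "(\<lambda>k. norm (y k) powr p k) \<longlonglongrightarrow> 0"
      by (simp add: maddox_c0_def)
    then have "\<forall>\<^sub>F k in sequentially. norm (y k) powr p k < 1 / L"
      using L by (intro order_tendstoD(2)) auto
    then obtain K where K: "\<And>k. K \<le> k \<Longrightarrow> norm (y k) powr p k < 1 / L"
      by (auto simp: eventually_sequentially)
    have tail: "norm (y k) \<le> w k" if "K \<le> k" for k
    proof -
      have "norm (y k) \<le> (1 / L) powr (1 / p k)"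
        using K[OF that] L p[of k] by (subst powr_inverse_exponent_le_iff[symmetric]) auto
      also have "\<dots> = w k"
        using L by (simp add: w_def powr_divide powr_minus_divide)
      finally show ?thesis .
    qed
    \<comment> \<open>The summand 1 covers the tail; the sum of ratios covers the finitely many
      terms before \<open>K\<close>.\<close>
    define C where "C = 1 + (\<Sum>k<K. norm (y k) / w k)"
    have C: "norm (y k) \<le> C * w k" for k
    proof (cases "K \<le> k")
      case True
      have "0 \<le> (\<Sum>k<K. norm (y k) / w k)"
        using less_imp_le[OF w] by (intro sum_nonneg) simp
      then have "1 * w k \<le> C * w k"
        using w[of k] by (intro mult_right_mono) (auto simp: C_def)
      then show ?thesis using tail[OF True] by simp
    next
      case False
      then have "norm (y k) / w k \<le> (\<Sum>k<K. norm (y k) / w k)"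
        using less_imp_le[OF w] by (intro member_le_sum) auto
      then have "norm (y k) / w k \<le> C" by (simp add: C_def)
      then show ?thesis using w[of k] by (simp add: pos_divide_le_eq)
    qed
    have "norm (\<Sum>k\<le>n. A n k * y k) \<le> C * b" for n
    proof -
      have "norm (\<Sum>k\<le>n. A n k * y k) \<le> (\<Sum>k\<le>n. norm (A n k) * (C * w k))"
        by (intro sum_norm_le) (auto simp: norm_mult intro: mult_left_mono C)
      also have "\<dots> = C * (\<Sum>k\<le>n. norm (A n k) * w k)"
        by (simp add: sum_distrib_left mult_ac)
      also have "\<dots> \<le> C * b"
      proof (rule mult_left_mono)
        show "(\<Sum>k\<le>n. norm (A n k) * w k) \<le> b"
          unfolding w_def by (rule b)
        show "0 \<le> C"
          using less_imp_le[OF w] by (simp add: C_def sum_nonneg)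
      qed
      finally show ?thesis .
    qed
    then show "Bseq (\<lambda>n. \<Sum>k\<le>n. A n k * y k)"
      by (rule BseqI')
  qed
qed

text \<open>A single failing \<open>L\<close> serves all blocks, so admissibility is the same at
  every stage and the glued sequence is in linf(p). Conversely, the bound \<open>L\<close> depends
  on \<open>y\<close>, which explains the quantifier over all \<open>L\<close>.\<close>

lemma maddox_linf_bounded_iff:
  fixes A :: "nat \<Rightarrow> nat \<Rightarrow> 'a::real_normed_field"
  assumes tri: "\<And>n k. n < k \<Longrightarrow> A n k = 0" and p: "\<And>k. 0 < p k"
  shows "(\<forall>y\<in>maddox_linf p. Bseq (\<lambda>n. \<Sum>k\<le>n. A n k * y k)) \<longleftrightarrow>
    (\<forall>L\<in>{1::nat..}. bdd_above (range (\<lambda>n. \<Sum>k\<le>n. norm (A n k) * real L powr (1 / p k))))"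
    (is "?lhs \<longleftrightarrow> ?rhs")
proof
  assume bd: ?lhs
  show ?rhs
  proof (intro ballI, rule ccontr)
    fix L :: nat assume "L \<in> {1..}"
      and unbdd: "\<not> bdd_above (range (\<lambda>n. \<Sum>k\<le>n. norm (A n k) * real L powr (1 / p k)))"
    then have L: "1 \<le> L" by simp
    have col: "Bseq (\<lambda>n. A n k)" for k
      using tri order_trans[OF maddox_l_subset_c0 maddox_c0_subset_linf] bd by (rule column_Bseq)
    define P where "P m I z \<longleftrightarrow> (\<forall>k\<in>I. norm (z k) powr p k \<le> L)"
      for m :: nat and I and z :: "nat \<Rightarrow> 'a"
    have hump: "\<exists>n z. K \<le> n \<and> P m {K..n} z \<and> B \<le> norm (\<Sum>k=K..n. A n k * z k)" for m K B
    proof -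
      define w where "w k = real L powr (1 / p k)" for k
      obtain n where n: "K \<le> n" "B \<le> (\<Sum>k=K..n. norm (A n k) * w k)"
        using unbdd[folded w_def]
        by (rule unbounded_row_tail[rotated 2])
          (auto simp: w_def intro: bdd_above_norm_mult_column col)
      obtain z where z: "\<And>k. norm (z k) = w k"
        "\<And>I. norm (\<Sum>k\<in>I. A n k * z k) = (\<Sum>k\<in>I. norm (A n k) * w k)"
        by (rule aligned_vector[of w "A n"]) (auto simp: w_def)
      have "norm (z k) powr p k = L" for k
        using p[of k] L by (simp add: z w_def powr_powr)
      then have "P m {K..n} z" by (simp add: P_def)
      with n show ?thesis by (intro exI[of _ n] exI[of _ z]) (simp add: z(2))
    qed
    obtain y K where K: "strict_mono K" "K 0 = 0" and y: "\<And>m. P m {K m..<K (Suc m)} y"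
      and unb: "\<not> Bseq (\<lambda>n. \<Sum>k\<le>n. A n k * y k)"
      by (rule gliding_hump[where A = A and P = P, OF col _ hump]) (auto simp: P_def)
    \<comment> \<open>Since \<open>K 0 = 0\<close>, the blocks cover every index.\<close>
    have "norm (y k) powr p k \<le> L" for k
      using strict_mono_block[OF K(1), of 0 k] y K(2) unfolding P_def by (metis le0)
    then have "y \<in> maddox_linf p"
      unfolding maddox_linf_def mem_Collect_eq by (rule bdd_aboveI2)
    with bd unb show False by blast
  qed
next
  assume bd: ?rhs
  show ?lhs
  proof
    fix y :: "nat \<Rightarrow> 'a" assume "y \<in> maddox_linf p"
    then obtain c where c: "\<And>k. norm (y k) powr p k \<le> c"
      by (auto simp: maddox_linf_def bdd_above_def)
    obtain L :: nat where "max c 1 \<le> real L"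
      using real_arch_simple by blast
    then have L: "1 \<le> L" "c \<le> real L" by auto
    obtain b where b: "\<And>n. (\<Sum>k\<le>n. norm (A n k) * real L powr (1 / p k)) \<le> b"
      using bd L(1) by (auto simp: bdd_above_def)
    have y: "norm (y k) \<le> real L powr (1 / p k)" for k
      using c[of k] L p[of k] by (subst powr_inverse_exponent_le_iff[symmetric]) auto
    have "norm (\<Sum>k\<le>n. A n k * y k) \<le> b" for n
    proof -
      have "norm (\<Sum>k\<le>n. A n k * y k) \<le> (\<Sum>k\<le>n. norm (A n k) * real L powr (1 / p k))"
        by (intro sum_norm_le) (auto simp: norm_mult intro: mult_left_mono y)
      then show ?thesis using b[of n] by linarith
    qed
    then show "Bseq (\<lambda>n. \<Sum>k\<le>n. A n k * y k)"
      by (rule BseqI')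
  qed
qed

text \<open>c(p) consists of c0(p) shifted by constants, and the constant sequence 1 tests the row
  sums.\<close>

lemma maddox_c_bounded_iff:
  fixes A :: "nat \<Rightarrow> nat \<Rightarrow> 'a::real_normed_field"
  shows "(\<forall>y\<in>maddox_c p. Bseq (\<lambda>n. \<Sum>k\<le>n. A n k * y k)) \<longleftrightarrow>
    (\<forall>y\<in>maddox_c0 p. Bseq (\<lambda>n. \<Sum>k\<le>n. A n k * y k)) \<and> Bseq (\<lambda>n. \<Sum>k\<le>n. A n k)"
    (is "?lhs \<longleftrightarrow> ?rhs")
proof
  assume bd: ?lhs
  have "maddox_c0 p \<subseteq> (maddox_c p :: (nat \<Rightarrow> 'a) set)"
    by (auto simp: maddox_c0_def maddox_c_def intro: exI[of _ 0])
  moreover have "(\<lambda>k. 1 :: 'a) \<in> maddox_c p"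
    by (auto simp: maddox_c_def intro: exI[of _ 1])
  ultimately show ?rhs
    using bd by fastforce
next
  assume bd: ?rhs
  show ?lhs
  proof
    fix y :: "nat \<Rightarrow> 'a" assume "y \<in> maddox_c p"
    then obtain l where "(\<lambda>k. y k - l) \<in> maddox_c0 p"
      by (auto simp: maddox_c_def maddox_c0_def)
    then have "Bseq (\<lambda>n. \<Sum>k\<le>n. A n k * (y k - l))"
      by (rule bspec[OF conjunct1[OF bd]])
    then obtain b where b: "\<And>n. norm (\<Sum>k\<le>n. A n k * (y k - l)) \<le> b"
      by (auto simp: Bseq_def)
    obtain c where c: "\<And>n. norm (\<Sum>k\<le>n. A n k) \<le> c"
      using bd by (auto simp: Bseq_def)
    have "norm (\<Sum>k\<le>n. A n k * y k) \<le> b + c * norm l" for n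
    proof -
      have "(\<Sum>k\<le>n. A n k * y k) = (\<Sum>k\<le>n. A n k * (y k - l)) + (\<Sum>k\<le>n. A n k) * l"
        by (simp add: sum_distrib_right sum.distrib[symmetric] flip: distrib_left)
      also have "norm \<dots> \<le> b + c * norm l"
        using b c by (intro norm_triangle_mono) (auto simp: norm_mult intro: mult_right_mono)
      finally show ?thesis .
    qed
    then show "Bseq (\<lambda>n. \<Sum>k\<le>n. A n k * y k)"
      by (rule BseqI')
  qed
qed

section \<open>Matrix conditions for l(p)\<close>

lemma summable_of_geometric_blocks:
  fixes f :: "nat \<Rightarrow> real"
  assumes nonneg: "\<And>k. 0 \<le> f k" and K: "strict_mono K" "K 0 = 0"
    and block: "\<And>m. (\<Sum>k\<in>{K m..<K (Suc m)}. f k) \<le> (1 / 2) ^ m"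
  shows "summable f"
proof (rule bounded_imp_summable)
  have "(\<Sum>k<K m. f k) \<le> (\<Sum>i<m. (1 / 2) ^ i)" for m
  proof (induction m)
    case (Suc m)
    have "K m \<le> K (Suc m)"
      using K(1) by (simp add: strict_mono_less_eq)
    then have "(\<Sum>k<K (Suc m). f k) = (\<Sum>k<K m. f k) + (\<Sum>k\<in>{K m..<K (Suc m)}. f k)"
      using sum.atLeastLessThan_concat[of 0 "K m" "K (Suc m)" f] by (simp add: atLeast0LessThan)
    then show ?case using Suc block[of m] by simp
  qed (simp add: K)
  also have "(\<Sum>i<m. (1 / 2 :: real) ^ i) \<le> 2" for m
    using geometric_sum[of "1 / 2 :: real" m] by simp
  finally have blocks: "(\<Sum>k<K m. f k) \<le> 2" for m .
  show "(\<Sum>k\<le>n. f k) \<le> 2" for n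
  proof -
    have "Suc n \<le> K (Suc n)"
      using K(1) by (rule strict_mono_imp_increasing)
    then have "(\<Sum>k\<le>n. f k) \<le> (\<Sum>k<K (Suc n). f k)"
      using nonneg by (intro sum_mono2) auto
    then show ?thesis using blocks[of "Suc n"] by linarith
  qed
qed (rule nonneg)

text \<open>Blocks whose sums of \<open>p k\<close>-th powers are at most \<open>(1 / 2) ^ m\<close>
  glue to a member of l(p). Both necessity proofs for l(p) only have to produce such humps.\<close>

lemma maddox_l_no_hump:
  fixes A :: "nat \<Rightarrow> nat \<Rightarrow> 'a::real_normed_field"
  assumes tri: "\<And>n k. n < k \<Longrightarrow> A n k = 0"
    and bd: "\<forall>y\<in>maddox_l p. Bseq (\<lambda>n. \<Sum>k\<le>n. A n k * y k)"
    and hump: "\<And>m K B. \<exists>n z. K \<le> n \<and> (\<Sum>k=K..n. norm (z k) powr p k) \<le> (1 / 2) ^ m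
      \<and> B \<le> norm (\<Sum>k=K..n. A n k * z k)"
  shows False
proof -
  define P where "P m I z \<longleftrightarrow> (\<Sum>k\<in>I. norm (z k) powr p k) \<le> (1 / 2) ^ m"
    for m :: nat and I and z :: "nat \<Rightarrow> 'a"
  have col: "Bseq (\<lambda>n. A n k)" for k
    using tri order_refl bd by (rule column_Bseq)
  obtain y K where K: "strict_mono K" "K 0 = 0" and y: "\<And>m. P m {K m..<K (Suc m)} y"
    and unb: "\<not> Bseq (\<lambda>n. \<Sum>k\<le>n. A n k * y k)"
    by (rule gliding_hump[where A = A and P = P, OF col _ hump[folded P_def]])
      (auto simp: P_def cong: sum.cong)
  have "summable (\<lambda>k. norm (y k) powr p k)"
    using K y[unfolded P_def] by (intro summable_of_geometric_blocks[of _ K]) auto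
  with bd unb show False by (simp add: maddox_l_def)
qed

text \<open>Necessity uses humps with one nonzero entry, \<open>L / A n k\<close>, small because the
  scaled matrix entry has a large power. Sufficiency rests on \<open>v \<le> v powr p k\<close> for
  \<open>v\<close> in the unit interval and \<open>p k \<le> 1\<close>.\<close>

lemma maddox_l_bounded_iff_le_1:
  fixes A :: "nat \<Rightarrow> nat \<Rightarrow> 'a::real_normed_field"
  assumes tri: "\<And>n k. n < k \<Longrightarrow> A n k = 0" and p: "\<And>k. 0 < p k" "\<And>k. p k \<le> 1"
  shows "(\<forall>y\<in>maddox_l p. Bseq (\<lambda>n. \<Sum>k\<le>n. A n k * y k)) \<longleftrightarrow>
    (\<exists>L\<in>{1::nat..}. bdd_above (range (\<lambda>(n, k). norm (A n k / of_nat L) powr p k)))"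
    (is "?lhs \<longleftrightarrow> ?rhs")
proof
  assume bd: ?lhs
  show ?rhs
  proof (rule ccontr)
    assume unbdd: "\<not> ?rhs"
    have "Bseq (\<lambda>n. A n k)" for k
      using tri order_refl bd by (rule column_Bseq)
    then have "\<exists>b. \<forall>n. norm (A n k) \<le> b" for k
      by (auto simp: Bseq_def)
    then obtain b where b: "\<And>n k. norm (A n k) \<le> b k"
      by metis
    have "\<exists>n z. K \<le> n \<and> (\<Sum>k=K..n. norm (z k) powr p k) \<le> (1 / 2) ^ m
      \<and> B \<le> norm (\<Sum>k=K..n. A n k * z k)" for m K :: nat and B :: real
    proof -
      obtain L :: nat where "max B 1 \<le> real L"
        using real_arch_simple by blast
      then have L: "1 \<le> L" "B \<le> real L" by auto
      \<comment> \<open>The term \<open>2 ^ m\<close> makes the hump small; the sum, a bound for the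
        columns before \<open>K\<close>, forces the large entry into a later column.\<close>
      define M where "M = 2 ^ m + (\<Sum>k<K. (b k / L) powr p k)"
      have "\<not> bdd_above (range (\<lambda>(n, k). norm (A n k / of_nat L) powr p k))"
        using unbdd L(1) by auto
      then obtain n k where nk: "M < norm (A n k / of_nat L) powr p k"
        by (force simp: bdd_above_def not_le)
      then have large: "M < (norm (A n k) / L) powr p k"
        by (simp add: norm_divide)
      have head: "0 \<le> (\<Sum>k<K. (b k / L) powr p k)"
        by (simp add: sum_nonneg)
      have "(1::real) \<le> 2 ^ m" by simp
      then have M: "1 \<le> M" "2 ^ m \<le> M"
        using head unfolding M_def by linarith+
      have Ank: "A n k \<noteq> 0"
        using large M by auto
      then have "k \<le> n" using tri[of n k] by (cases "k \<le> n") auto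
      moreover have "K \<le> k"
      proof (rule ccontr)
        assume "\<not> K \<le> k"
        then have "(b k / L) powr p k \<le> (\<Sum>k<K. (b k / L) powr p k)"
          by (intro member_le_sum) auto
        moreover have "(norm (A n k) / L) powr p k \<le> (b k / L) powr p k"
          using p(1)[of k] b by (intro powr_mono2 divide_right_mono) auto
        moreover have "(0::real) < 2 ^ m" by simp
        ultimately show False
          using large unfolding M_def by linarith
      qed
      ultimately have k: "k \<in> {K..n}" by simp
      define z where "z j = (if j = k then of_nat L / A n k else 0)" for j
      have "(\<Sum>j=K..n. norm (z j) powr p j) = (\<Sum>j=K..n. if j = k then (L / norm (A n k)) powr p k else 0)"
        by (intro sum.cong) (auto simp: z_def norm_divide)
      also have "\<dots> = 1 / (norm (A n k) / L) powr p k"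
        using k Ank L(1) by (simp add: powr_divide)
      also have "\<dots> \<le> 1 / 2 ^ m"
        using large M L(1) by (intro divide_left_mono mult_pos_pos) auto
      finally have "(\<Sum>j=K..n. norm (z j) powr p j) \<le> (1 / 2) ^ m"
        by (simp add: power_divide)
      moreover have "(\<Sum>j=K..n. A n j * z j) = (\<Sum>j=K..n. if j = k then of_nat L else 0)"
        using Ank by (intro sum.cong) (auto simp: z_def)
      then have "norm (\<Sum>j=K..n. A n j * z j) = L"
        using k by simp
      ultimately show ?thesis
        using k L(2) by (intro exI[of _ n] exI[of _ z]) auto
    qed
    with tri bd show False
      by (rule maddox_l_no_hump)
  qed
next
  assume ?rhs
  then obtain L :: nat and b where L: "1 \<le> L"
    and b: "\<And>n k. norm (A n k / of_nat L) powr p k \<le> b"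
    by (force simp: bdd_above_def)
  define M where "M = max b 1"
  have M: "1 \<le> M" "\<And>n k. (norm (A n k) / L) powr p k \<le> M"
    using b by (auto simp: M_def norm_divide intro: max.coboundedI1)
  show ?lhs
  proof
    fix y :: "nat \<Rightarrow> 'a" assume "y \<in> maddox_l p"
    then have sum_y: "summable (\<lambda>k. norm (y k) powr p k)"
      by (simp add: maddox_l_def)
    then have "\<forall>\<^sub>F k in sequentially. norm (y k) powr p k < 1 / M"
      using M(1) by (intro order_tendstoD(2)[OF summable_LIMSEQ_zero]) auto
    then obtain K where K: "\<And>k. K \<le> k \<Longrightarrow> norm (y k) powr p k < 1 / M"
      by (auto simp: eventually_sequentially)
    \<comment> \<open>The terms before \<open>K\<close>, where \<open>v\<close> below may exceed 1,
      are bounded separately; \<open>c\<close> has finite support and is thus summable.\<close>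
    define c where "c k = (if k < K then L * M powr (1 / p k) * norm (y k) else 0)" for k
    have bound: "norm (A n k * y k) \<le> c k + L * (M * norm (y k) powr p k)" for n k
    proof (cases "k < K")
      case True
      have "norm (A n k) / L \<le> M powr (1 / p k)"
        using M p(1)[of k] by (subst powr_inverse_exponent_le_iff[symmetric]) auto
      then have "norm (A n k) \<le> L * M powr (1 / p k)"
        using L by (simp add: pos_divide_le_eq mult.commute)
      then have "norm (A n k * y k) \<le> c k"
        using True by (simp add: c_def norm_mult mult_right_mono)
      moreover have "0 \<le> L * (M * norm (y k) powr p k)"
        using M(1) by simp
      ultimately show ?thesis by linarith
    next
      case False
      define v where "v = norm (A n k) / L * norm (y k)"
      have v0: "0 \<le> v" by (simp add: v_def)
      have "v powr p k = (norm (A n k) / L) powr p k * norm (y k) powr p k"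
        unfolding v_def by (rule powr_mult)
      also have "\<dots> \<le> M * norm (y k) powr p k"
        using M(2) by (intro mult_right_mono) auto
      finally have v: "v powr p k \<le> M * norm (y k) powr p k" .
      also have "\<dots> \<le> 1"
        using less_imp_le[OF K[of k]] False M(1) by (simp add: pos_le_divide_eq mult.commute)
      finally have "v \<le> 1"
        using powr_inverse_exponent_le_iff[of "p k" v 1] v0 p(1) by simp
      then have "v powr 1 \<le> v powr p k"
        using v0 p(2)[of k] by (intro powr_mono') auto
      then have "v \<le> M * norm (y k) powr p k"
        using v v0 by simp
      then have "L * v \<le> L * (M * norm (y k) powr p k)"
        by (intro mult_left_mono) auto
      moreover have "norm (A n k * y k) = L * v"
        using L by (simp add: v_def norm_mult)
      ultimately show ?thesis
        using False by (simp add: c_def)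
    qed
    have "summable c"
      by (rule summable_finite[of "{..<K}"]) (auto simp: c_def)
    then have summ: "summable (\<lambda>k. c k + L * (M * norm (y k) powr p k))"
      using sum_y by (intro summable_add summable_mult)
    have "norm (\<Sum>k\<le>n. A n k * y k) \<le> (\<Sum>k. c k + L * (M * norm (y k) powr p k))" for n
    proof -
      have "norm (\<Sum>k\<le>n. A n k * y k) \<le> (\<Sum>k\<le>n. c k + L * (M * norm (y k) powr p k))"
        by (rule sum_norm_le) (rule bound)
      also have "\<dots> \<le> (\<Sum>k. c k + L * (M * norm (y k) powr p k))"
        using summ M(1) by (intro sum_le_suminf) (auto simp: c_def)
      finally show ?thesis .
    qed
    then show "Bseq (\<lambda>n. \<Sum>k\<le>n. A n k * y k)"
      by (rule BseqI')
  qed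
qed

text \<open>Necessity takes the extremal vector of Hoelder's inequality, with moduli proportional to
  \<open>(norm (A n k) / L) powr (conj_exp p k - 1)\<close>. Sufficiency is the weak Young
  inequality applied termwise.\<close>

lemma maddox_l_bounded_iff_gt_1:
  fixes A :: "nat \<Rightarrow> nat \<Rightarrow> 'a::real_normed_field"
  assumes tri: "\<And>n k. n < k \<Longrightarrow> A n k = 0" and p: "\<And>k. 1 < p k"
  shows "(\<forall>y\<in>maddox_l p. Bseq (\<lambda>n. \<Sum>k\<le>n. A n k * y k)) \<longleftrightarrow>
    (\<exists>L\<in>{1::nat..}. bdd_above (range (\<lambda>n. \<Sum>k\<le>n. norm (A n k / of_nat L) powr conj_exp p k)))"
    (is "?lhs \<longleftrightarrow> ?rhs")
proof
  assume bd: ?lhs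
  show ?rhs
  proof (rule ccontr)
    assume unbdd: "\<not> ?rhs"
    have col: "Bseq (\<lambda>n. A n k)" for k
      using tri order_refl bd by (rule column_Bseq)
    have "\<exists>n z. K \<le> n \<and> (\<Sum>k=K..n. norm (z k) powr p k) \<le> (1 / 2) ^ m
      \<and> B \<le> norm (\<Sum>k=K..n. A n k * z k)" for m K :: nat and B :: real
    proof -
      \<comment> \<open>The hump will have norm exactly \<open>L / 2 ^ m\<close>, so this
        \<open>L\<close> makes it at least \<open>B\<close>.\<close>
      obtain L :: nat where "max (B * 2 ^ m) 1 \<le> real L"
        using real_arch_simple by blast
      then have L: "1 \<le> L" "B * 2 ^ m \<le> real L" by auto
      define f where "f n k = (norm (A n k) / L) powr conj_exp p k" for n k
      have q: "0 < conj_exp p k" for k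
        using p[of k] by (simp add: conj_exp_def)
      have "bdd_above (range (\<lambda>n. f n k))" for k
      proof -
        obtain b where "\<And>n. norm (A n k) \<le> b"
          using col[of k] by (auto simp: Bseq_def)
        then have "f n k \<le> (b / L) powr conj_exp p k" for n
          unfolding f_def using q[of k] by (intro powr_mono2 divide_right_mono) auto
        then show ?thesis by (rule bdd_aboveI2)
      qed
      moreover have "\<not> bdd_above (range (\<lambda>n. \<Sum>k\<le>n. f n k))"
        using unbdd L(1) by (auto simp: f_def norm_divide)
      ultimately obtain n where n: "K \<le> n" "1 \<le> (\<Sum>k=K..n. f n k)"
        by (rule unbounded_row_tail[rotated]) (auto simp: f_def)
      define S where "S = (\<Sum>k=K..n. f n k)"
      \<comment> \<open>The exponents vary with \<open>k\<close>, so no common root normalizes the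
        block. Instead \<open>\<theta> * S = (1 / 2) ^ m\<close>, and
        \<open>\<theta> \<le> 1\<close> with \<open>p k > 1\<close> gives
        \<open>\<theta> powr p k \<le> \<theta>\<close>.\<close>
      define \<theta> where "\<theta> = 1 / (2 ^ m * S)"
      have S: "1 \<le> S" using n(2) by (simp add: S_def)
      have "1 * 1 \<le> 2 ^ m * S"
        using S by (intro mult_mono) auto
      then have \<theta>: "0 < \<theta>" "\<theta> \<le> 1"
        by (auto simp: \<theta>_def)
      have \<theta>S: "\<theta> * S = (1 / 2) ^ m"
        using S by (simp add: \<theta>_def power_divide)
      define w where "w k = \<theta> * (norm (A n k) / L) powr (conj_exp p k - 1)" for k
      have wp: "w k powr p k \<le> \<theta> * f n k" for k
      proof -
        have "(conj_exp p k - 1) * p k = conj_exp p k"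
          using p[of k] by (simp add: conj_exp_def field_simps)
        then have "w k powr p k = \<theta> powr p k * f n k"
          using \<theta> by (simp add: w_def f_def powr_mult powr_powr)
        also have "\<theta> powr p k \<le> \<theta> powr 1"
          using \<theta> p[of k] by (intro powr_mono') auto
        then have "\<theta> powr p k * f n k \<le> \<theta> * f n k"
          using \<theta> by (intro mult_right_mono) (auto simp: f_def)
        finally show ?thesis .
      qed
      have Aw: "norm (A n k) * w k = \<theta> * L * f n k" for k
      proof (cases "A n k = 0")
        case False
        then have "norm (A n k) / L * (norm (A n k) / L) powr (conj_exp p k - 1) = f n k"
          using L(1) powr_add[of "norm (A n k) / L" 1 "conj_exp p k - 1"] by (simp add: f_def)
        then show ?thesis
          using L(1) by (simp add: w_def field_simps)
      qed (simp add: f_def)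
      obtain z where z: "\<And>k. norm (z k) = w k"
        "\<And>I. norm (\<Sum>k\<in>I. A n k * z k) = (\<Sum>k\<in>I. norm (A n k) * w k)"
        by (rule aligned_vector[of w "A n"]) (use \<theta> in \<open>auto simp: w_def\<close>)
      have "(\<Sum>k=K..n. norm (z k) powr p k) \<le> (\<Sum>k=K..n. \<theta> * f n k)"
        unfolding z(1) by (rule sum_mono) (rule wp)
      also have "\<dots> = (1 / 2) ^ m"
        using \<theta>S by (simp add: S_def sum_distrib_left)
      finally have small: "(\<Sum>k=K..n. norm (z k) powr p k) \<le> (1 / 2) ^ m" .
      have "norm (\<Sum>k=K..n. A n k * z k) = L * (\<theta> * S)"
        unfolding z(2) Aw by (simp add: S_def sum_distrib_left mult_ac)
      also have "\<dots> = L / 2 ^ m"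
        by (simp add: \<theta>S power_divide)
      finally have "B \<le> norm (\<Sum>k=K..n. A n k * z k)"
        using L(2) by (simp add: pos_le_divide_eq)
      with small n(1) show ?thesis by blast
    qed
    with tri bd show False
      by (rule maddox_l_no_hump)
  qed
next
  assume ?rhs
  then obtain L :: nat and b where L: "1 \<le> L"
    and "\<And>n. (\<Sum>k\<le>n. norm (A n k / of_nat L) powr conj_exp p k) \<le> b"
    by (auto simp: bdd_above_def)
  then have b: "\<And>n. (\<Sum>k\<le>n. (norm (A n k) / L) powr conj_exp p k) \<le> b"
    by (simp add: norm_divide)
  show ?lhs
  proof
    fix y :: "nat \<Rightarrow> 'a" assume "y \<in> maddox_l p"
    then have sum_y: "summable (\<lambda>k. norm (y k) powr p k)"
      by (simp add: maddox_l_def)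
    have "norm (\<Sum>k\<le>n. A n k * y k) \<le> L * (b + (\<Sum>k. norm (y k) powr p k))" for n
    proof -
      have "norm (\<Sum>k\<le>n. A n k * y k) \<le>
          (\<Sum>k\<le>n. L * ((norm (A n k) / L) powr conj_exp p k + norm (y k) powr p k))"
      proof (rule sum_norm_le)
        fix k
        have "norm (A n k * y k) = L * (norm (A n k) / L * norm (y k))"
          using L by (simp add: norm_mult)
        also have "\<dots> \<le> L * ((norm (A n k) / L) powr conj_exp p k + norm (y k) powr p k)"
          unfolding conj_exp_def using p[of k] by (intro mult_left_mono mult_le_powr_add_powr) auto
        finally show "norm (A n k * y k) \<le> \<dots>" .
      qed
      also have "\<dots> = L * ((\<Sum>k\<le>n. (norm (A n k) / L) powr conj_exp p k) + (\<Sum>k\<le>n. norm (y k) powr p k))"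
        by (simp only: sum_distrib_left[symmetric] sum.distrib)
      also have "\<dots> \<le> L * (b + (\<Sum>k. norm (y k) powr p k))"
        using b sum_y by (intro mult_left_mono add_mono sum_le_suminf) auto
      finally show ?thesis .
    qed
    then show "Bseq (\<lambda>n. \<Sum>k\<le>n. A n k * y k)"
      by (rule BseqI')
  qed
qed

section \<open>Assembly of the five duals\<close>

lemma Bseq_iff_bdd_above_norm:
  fixes f :: "nat \<Rightarrow> 'a::real_normed_vector"
  shows "Bseq f \<longleftrightarrow> bdd_above (range (\<lambda>n. norm (f n)))"
proof
  assume "bdd_above (range (\<lambda>n. norm (f n)))"
  then obtain b where "\<And>n. norm (f n) \<le> b"
    by (auto simp: bdd_above_def)
  then show "Bseq f" by (rule BseqI')
qed (auto simp: Bseq_def bdd_above_def)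

theorem theorem4p4:
  fixes r s t :: "nat \<Rightarrow> 'a::real_normed_field" and p :: "nat \<Rightarrow> real" and H :: real
  assumes "\<forall>n. r n \<noteq> 0" and "\<forall>n. t n \<noteq> 0" and "s 0 \<noteq> 0"
    and "\<forall>k. 0 < p k" and "bdd_above (range p)" and "H = (SUP k. p k)"
  shows
    "((\<forall>k. p k > 1) \<longrightarrow> gamma_dual (l_space r s t p) = Gamma5 r s t p) \<and>
     ((\<forall>k. 0 < p k \<and> p k \<le> 1) \<longrightarrow> gamma_dual (l_space r s t p) = Gamma4 r s t p) \<and>
     ((\<forall>k. 0 < p k \<and> p k \<le> H) \<longrightarrow>
        gamma_dual (c0_space r s t p) = Gamma1 r s t p \<and>
        gamma_dual (c_space r s t p) = Gamma1 r s t p \<inter> Gamma2 r s t \<and>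
        gamma_dual (linf_space r s t p) = Gamma3 r s t p)"
proof -
  note dual = gamma_dual_mean_diff_space[where r = r and s = s and t = t, OF assms(1,2,3)]
  have p: "0 < p k" for k using assms(4) by simp
  have tri: "E_mat r s t a n k = 0" if "n < k" for a n k
    using that by (simp add: E_mat_def)
  \<comment> \<open>Triangularity turns the series in the Gamma sets into the finite row sums of the
    matrix criteria.\<close>
  have row_sums:
    "(\<Sum>k. E_mat r s t a n k) = (\<Sum>k\<le>n. E_mat r s t a n k)"
    "(\<Sum>k. norm (E_mat r s t a n k) * w k) = (\<Sum>k\<le>n. norm (E_mat r s t a n k) * w k)"
    "(\<Sum>k. norm (E_mat r s t a n k / b) powr q k) = (\<Sum>k\<le>n. norm (E_mat r s t a n k / b) powr q k)"
    for a n b and w q :: "nat \<Rightarrow> real"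
    by (rule suminf_triangle; simp add: tri)+
  have c0: "gamma_dual (c0_space r s t p) = Gamma1 r s t p"
    unfolding c0_space_def dual Gamma1_def row_sums
    by (simp add: maddox_c0_bounded_iff[OF tri p] set_eq_iff)
  moreover have "gamma_dual (linf_space r s t p) = Gamma3 r s t p"
    unfolding linf_space_def dual Gamma3_def row_sums
    by (simp add: maddox_linf_bounded_iff[OF tri p] set_eq_iff)
  moreover have "Gamma2 r s t = {a. Bseq (\<lambda>n. \<Sum>k\<le>n. E_mat r s t a n k)}"
    unfolding Gamma2_def row_sums Bseq_iff_bdd_above_norm ..
  \<comment> \<open>\<open>Gamma1\<close> is rewritten back into the dual of the c0 space, so that
    the splitting of c(p) into c0(p) and constants applies directly.\<close>
  then have "gamma_dual (c_space r s t p) = Gamma1 r s t p \<inter> Gamma2 r s t"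
    unfolding c0[symmetric] c0_space_def c_space_def dual maddox_c_bounded_iff by blast
  moreover have "gamma_dual (l_space r s t p) = Gamma5 r s t p" if "\<forall>k. p k > 1"
    unfolding l_space_def dual Gamma5_def row_sums
    using that by (simp add: maddox_l_bounded_iff_gt_1[OF tri] set_eq_iff)
  moreover have "gamma_dual (l_space r s t p) = Gamma4 r s t p" if "\<forall>k. 0 < p k \<and> p k \<le> 1"
    unfolding l_space_def dual Gamma4_def
    using that by (simp add: maddox_l_bounded_iff_le_1[OF tri] set_eq_iff)
  ultimately show ?thesis by blast
qed

end
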